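(* Suppose $\gamma=0$ and $\rho=0$. Take $\tau_0,\sigma_0>0$ with $\tau_0\sigma_0\|K\|^2<1$, $\lambda_0=\mu_0=1$, $\epsilon\in[0,1)$, and update for $i\in\mathbb N$ $$\tau_{i+1}:=\tau_i\lambda_i^{-1}\lambda_{i+1},\qquad \omega_i:=1,\qquad \sigma_{i+1}:=\sigma_i\lambda_i^{-1}\lambda_{i+1},\qquad \mu_{i+1}:=\lambda_{i+1}:=\frac{\lambda_i}{1+(1-\epsilon)\lambda_i}.$$ Then the iterates $u^N=(x^N,y^N)$ generated by the IC-PDPS algorithm (defined in the context) satisfy $\mathcal G(u^N;\widehat u)\to0$ at the rate $O(1/N)$ for any $\widehat u=(\widehat x,\widehat y)\in H^{-1}(0)$.
   Context: $X,Y$ are (real) Hilbert spaces, $K\in\mathcal L(X;Y)$ is bounded linear, $G:X\to[-\infty,\infty]$ and $F^*:Y\to[-\infty,\infty]$ are convex, proper, lower semicontinuous, and (strongly) convex with factors $\gamma\ge0$ and $\rho\ge0$ respectively (i.e. $G-\frac\gamma2\|\cdot\|^2$ and $F^*-\frac\rho2\|\cdot\|^2$ are convex). $F^*$ is the Fenchel conjugate of a convex, proper, lower semicontinuous $F$. The set $H^{-1}(0)$ consists of the pairs $\widehat u=(\widehat x,\widehat y)\in X\times Y$ with $-K^*\widehat y\in\partial G(\widehat x)$ and $K\widehat x\in\partial F^*(\widehat y)$. $\mathbb N=\{0,1,2,\dots\}$. The proximal map is $\operatorname{prox}_{tG}(v):=\arg\min_x\, tG(x)+\frac12\|x-v\|^2$,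 i.e. $(I+t\partial G)^{-1}(v)$. IC-PDPS algorithm (inertial, corrected, primal-dual proximal splitting), for given parameters $(\tau_i,\sigma_{i+1},\lambda_i,\mu_{i+1},\omega_i)_{i\in\mathbb N}$: take arbitrary $\tilde x^0:=\bar x^0:=x^0\in X$ and $\tilde y^0:=\bar y^0:=y^0\in\operatorname{dom}\partial F^*$, and for $i=0,1,2,\dots$ set $\tilde\tau_i:=\tau_i/[1+\gamma\tau_i(\lambda_i^{-1}-1)]$, $\tilde\sigma_{i+1}:=\sigma_{i+1}/[1+\rho\sigma_{i+1}(\mu_{i+1}^{-1}-1)]$, $x^i_\gamma:=[\bar x^i+\gamma\tau_i(\lambda_i^{-1}-1)x^i]/[1+\gamma\tau_i(\lambda_i^{-1}-1)]$, $x^{i+1}:=\operatorname{prox}_{\tilde\tau_iG}(x^i_\gamma-\tilde\tau_iK^*\tilde y^i)$, $\bar x^{i+1}:=x^{i+1}+\lambda_{i+1}(\lambda_i^{-1}-1)(x^{i+1}-x^i)$, $\tilde x^{i+1}:=x^{i+1}+(\lambda_i^{-1}-1)(x^{i+1}-x^i)$, $y^i_\rho:=[\bar y^i+\rho\sigma_{i+1}(\mu_{i+1}^{-1}-1)y^i]/[1+\rho\sigma_{i+1}(\mu_{i+1}^{-1}-1)]$, $y^{i+1}:=\operatorname{prox}_{\tilde\sigma_{i+1}F^*}(y^i_\rho+\tilde\sigma_{i+1}K[\tilde x^{i+1}+\omega_i(\tilde x^{i+1}-\tilde x^i)])$, $\bar y^{i+1}:=y^{i+1}+\mu_{i+2}(\mu_{i+1}^{-1}-1)(y^{i+1}-y^i)$,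 $\tilde y^{i+1}:=y^{i+1}+(\mu_{i+1}^{-1}-1)(y^{i+1}-y^i)$. The Lagrangian duality gap is $$\mathcal G(x,y;\widehat x,\widehat y):=\bigl(G(x)+\langle\widehat y,Kx\rangle-F^*(\widehat y)\bigr)-\bigl(G(\widehat x)+\langle y,K\widehat x\rangle-F^*(y)\bigr).$$ *)

theory Defs
  imports "HOL-Analysis.Analysis" "HOL-Library.Landau_Symbols"
begin

section \<open>Extended-real-valued convex functions\<close>

text \<open>
  In \<^typ>\<open>ereal\<close> we have \<^term>\<open>\<infinity> + (- \<infinity>) = (\<infinity> :: ereal)\<close>, the convention under which this
  inequality is equivalent to convexity of the epigraph also for functions that take
  the value \<^term>\<open>- \<infinity> :: ereal\<close>.
\<close>

definition convex_fun :: "('a::real_vector \<Rightarrow> ereal) \<Rightarrow> bool" where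
  "convex_fun f \<longleftrightarrow> (\<forall>x y. \<forall>t\<in>{0<..<1::real}.
     f ((1 - t) *\<^sub>R x + t *\<^sub>R y) \<le> ereal (1 - t) * f x + ereal t * f y)"

definition strongly_convex_fun :: "real \<Rightarrow> ('a::real_inner \<Rightarrow> ereal) \<Rightarrow> bool" where
  "strongly_convex_fun \<gamma> f \<longleftrightarrow> convex_fun (\<lambda>x. f x - ereal (\<gamma> / 2 * (norm x)\<^sup>2))"

definition proper_fun :: "('a \<Rightarrow> ereal) \<Rightarrow> bool" where
  "proper_fun f \<longleftrightarrow> (\<forall>x. f x \<noteq> - \<infinity>) \<and> (\<exists>x. f x \<noteq> \<infinity>)"

definition lsc_fun :: "('a::topological_space \<Rightarrow> ereal) \<Rightarrow> bool" where
  "lsc_fun f \<longleftrightarrow> (\<forall>x. f x \<le> Liminf (nhds x) f)"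

definition fenchel_conj :: "('a::real_inner \<Rightarrow> ereal) \<Rightarrow> 'a \<Rightarrow> ereal" where
  "fenchel_conj f p = (SUP x. ereal (p \<bullet> x) - f x)"

text \<open>
  For proper \<open>f\<close> the subdifferential is empty at every point where \<open>f\<close> is infinite.
\<close>

definition subdiff :: "('a::real_inner \<Rightarrow> ereal) \<Rightarrow> 'a \<Rightarrow> 'a set" where
  "subdiff f x = {p. \<forall>z. f x + ereal (p \<bullet> (z - x)) \<le> f z}"

definition dom_subdiff :: "('a::real_inner \<Rightarrow> ereal) \<Rightarrow> 'a set" where
  "dom_subdiff f = {x. subdiff f x \<noteq> {}}"

definition prox :: "real \<Rightarrow> ('a::real_inner \<Rightarrow> ereal) \<Rightarrow> 'a \<Rightarrow> 'a" where
  "prox t f v = arg_min (\<lambda>x. ereal t * f x + ereal (1 / 2 * (norm (x - v))\<^sup>2)) (\<lambda>_. True)"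

section \<open>The saddle-point problem\<close>

text \<open>
  Below, \<open>Fs\<close> stands for the conjugate \<open>F\<^sup>*\<close>. The set of critical points is \<open>H\<^sup>-\<^sup>1(0)\<close>
  for the operator \<open>H (x, y) = (\<partial>G x + K\<^sup>* y, \<partial>F\<^sup>* y - K x)\<close>.
\<close>

definition critical_points ::
  "('a::real_inner \<Rightarrow> 'b::real_inner) \<Rightarrow> ('a \<Rightarrow> ereal) \<Rightarrow> ('b \<Rightarrow> ereal) \<Rightarrow> ('a \<times> 'b) set" where
  "critical_points K G Fs =
     {(xh, yh). - adjoint K yh \<in> subdiff G xh \<and> K xh \<in> subdiff Fs yh}"

definition lagrangian_gap ::
  "('a::real_inner \<Rightarrow> 'b::real_inner) \<Rightarrow> ('a \<Rightarrow> ereal) \<Rightarrow> ('b \<Rightarrow> ereal) \<Rightarrow> 'a \<times> 'b \<Rightarrow> 'a \<times> 'b \<Rightarrow> ereal"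
  where
  "lagrangian_gap K G Fs = (\<lambda>(x, y) (xh, yh).
     (G x + ereal (yh \<bullet> K x) - Fs yh) - (G xh + ereal (y \<bullet> K xh) - Fs y))"

section \<open>Inertial, corrected, primal-dual proximal splitting\<close>

text \<open>
  \<open>xb\<close>, \<open>yb\<close> are the barred and \<open>xt\<close>, \<open>yt\<close> the tilded sequences of the method. The values
  \<open>\<sigma> 0\<close> and \<open>mu 0\<close> are not used. All sequences are determined by \<open>x 0\<close> and \<open>y 0\<close>.
\<close>

definition ic_pdps ::
  "('a::real_inner \<Rightarrow> 'b::real_inner) \<Rightarrow> ('a \<Rightarrow> ereal) \<Rightarrow> ('b \<Rightarrow> ereal) \<Rightarrow> real \<Rightarrow> real \<Rightarrow>
   (nat \<Rightarrow> real) \<Rightarrow> (nat \<Rightarrow> real) \<Rightarrow> (nat \<Rightarrow> real) \<Rightarrow> (nat \<Rightarrow> real) \<Rightarrow> (nat \<Rightarrow> real) \<Rightarrow>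
   (nat \<Rightarrow> 'a) \<Rightarrow> (nat \<Rightarrow> 'a) \<Rightarrow> (nat \<Rightarrow> 'a) \<Rightarrow> (nat \<Rightarrow> 'b) \<Rightarrow> (nat \<Rightarrow> 'b) \<Rightarrow> (nat \<Rightarrow> 'b) \<Rightarrow> bool" where
  "ic_pdps K G Fs \<gamma> \<rho> \<tau> \<sigma> lam mu \<omega> x xb xt y yb yt \<longleftrightarrow>
     xt 0 = x 0 \<and> xb 0 = x 0 \<and> yt 0 = y 0 \<and> yb 0 = y 0 \<and> y 0 \<in> dom_subdiff Fs \<and>
     (\<forall>i.
        (let a = \<gamma> * \<tau> i * (inverse (lam i) - 1);
             \<tau>t = \<tau> i / (1 + a);
             x\<gamma> = (xb i + a *\<^sub>R x i) /\<^sub>R (1 + a)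
         in x (Suc i) = prox \<tau>t G (x\<gamma> - \<tau>t *\<^sub>R adjoint K (yt i))) \<and>
        xb (Suc i) = x (Suc i) + (lam (i + 1) * (inverse (lam i) - 1)) *\<^sub>R (x (Suc i) - x i) \<and>
        xt (Suc i) = x (Suc i) + (inverse (lam i) - 1) *\<^sub>R (x (Suc i) - x i) \<and>
        (let b = \<rho> * \<sigma> (i + 1) * (inverse (mu (i + 1)) - 1);
             \<sigma>t = \<sigma> (i + 1) / (1 + b);
             y\<rho> = (yb i + b *\<^sub>R y i) /\<^sub>R (1 + b)
         in y (Suc i) = prox \<sigma>t Fs
              (y\<rho> + \<sigma>t *\<^sub>R K (xt (Suc i) + \<omega> i *\<^sub>R (xt (Suc i) - xt i)))) \<and>
        yb (Suc i) = y (Suc i) + (mu (i + 2) * (inverse (mu (i + 1)) - 1)) *\<^sub>R (y (Suc i) - y i) \<and>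
        yt (Suc i) = y (Suc i) + (inverse (mu (i + 1)) - 1) *\<^sub>R (y (Suc i) - y i))"

end

theory Submission
  imports Defs
begin

text \<open>
  With \<open>\<theta> i = inverse (lam i) = 1 + (1 - \<epsilon>) * i\<close>, the inertial proximal steps become subgradient
  inclusions \<open>p\<in>\<partial>G(x\<^sub>i\<^sub>+\<^sub>1)\<close>, \<open>q\<in>\<partial>F\<^sup>*(y\<^sub>i\<^sub>+\<^sub>1)\<close> in which the increments of the corrected iterates
  \<open>xt\<close>, \<open>yt\<close> appear with the constant step lengths \<open>\<tau> 0\<close>, \<open>\<sigma> 0\<close>. Since
  \<open>xt\<^sub>i\<^sub>+\<^sub>1 = \<theta>\<^sub>i x\<^sub>i\<^sub>+\<^sub>1 - (\<theta>\<^sub>i - 1) x\<^sub>i\<close>, testing them against \<open>xt\<^sub>i\<^sub>+\<^sub>1 - xh\<close>, \<open>yt\<^sub>i\<^sub>+\<^sub>1 - yh\<close> bounds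
  \<open>\<theta>\<^sub>i a\<^sub>i\<^sub>+\<^sub>1 - (\<theta>\<^sub>i - 1) a\<^sub>i + \<theta>\<^sub>i\<^sub>+\<^sub>1 b\<^sub>i\<^sub>+\<^sub>1 - (\<theta>\<^sub>i\<^sub>+\<^sub>1 - 1) b\<^sub>i\<close> by the decrease of the usual
  primal-dual preconditioner norm of the corrected iterates. Here \<open>a\<close>, \<open>b\<close> are the Bregman distances
  to \<open>xh\<close>, \<open>yh\<close>, whose sum is the gap. As \<open>\<theta>\<^sub>i\<^sub>+\<^sub>1 - 1 \<le> \<theta>\<^sub>i\<close>, the quantity
  \<open>\<theta>\<^sub>i a\<^sub>i\<^sub>+\<^sub>1 + \<theta>\<^sub>i\<^sub>+\<^sub>1 b\<^sub>i\<^sub>+\<^sub>1\<close> plus that norm is nonincreasing, and \<open>\<theta>\<close> grows linearly.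
\<close>

section \<open>Subgradients and proximal maps\<close>

lemma subdiff_finite:
  assumes "proper_fun f" "p \<in> subdiff f x"
  shows "\<bar>f x\<bar> \<noteq> \<infinity>"
proof
  assume "\<bar>f x\<bar> = \<infinity>"
  with assms(1) have "f x = \<infinity>" by (auto simp: proper_fun_def)
  with assms(2) have "f z = \<infinity>" for z unfolding subdiff_def
    by (metis (mono_tags, lifting) \<open>f x = \<infinity>\<close> ereal_infty_less_eq(1) mem_Collect_eq plus_ereal.simps(2))
  with assms(1) show False by (auto simp: proper_fun_def)
qed

lemma subdiff_real_ineq:
  assumes "proper_fun f" "p \<in> subdiff f x" "\<bar>f z\<bar> \<noteq> \<infinity>"
  shows "real_of_ereal (f x) + p \<bullet> (z - x) \<le> real_of_ereal (f z)"
proof -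
  have "\<bar>f x\<bar> \<noteq> \<infinity>" by (rule subdiff_finite[OF assms(1,2)])
  moreover have "f x + ereal (p \<bullet> (z - x)) \<le> f z"
    using assms(2) by (simp add: subdiff_def)
  ultimately show ?thesis using assms(3)
    by (cases "f x"; cases "f z") auto
qed

text \<open>The bound \<open>b n\<close> varies with \<open>n\<close> because a minimizing sequence
  controls \<open>f (s n)\<close> only after the quadratic term, which itself moves, has been
  subtracted.\<close>

lemma lsc_fun_seq_le:
  assumes "lsc_fun f" and s: "s \<longlonglongrightarrow> x" and b: "b \<longlonglongrightarrow> L"
    and le: "\<And>n. f (s n) \<le> ereal (b n)"
  shows "f x \<le> ereal L"
proof (rule ccontr)
  assume "\<not> ?thesis"
  then obtain y where y: "ereal L < y" "y < f x" by (meson dense not_le)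
  have "eventually (\<lambda>w. y < f w) (nhds x)"
    using assms(1) y(2) unfolding lsc_fun_def le_Liminf_iff by blast
  then have "eventually (\<lambda>n. y < f (s n)) sequentially"
    using s unfolding filterlim_iff by blast
  then have "eventually (\<lambda>n. y \<le> ereal (b n)) sequentially"
    by eventually_elim (meson le le_less_trans less_imp_le less_le_trans)
  moreover have "(\<lambda>n. ereal (b n)) \<longlonglongrightarrow> ereal L" using b by simp
  ultimately have "y \<le> ereal L" by (intro tendsto_lowerbound[where F=sequentially]) auto
  with y show False by simp
qed

lemma midpoint_norm_identity:
  fixes a b v :: "'a::real_inner"
  shows "(norm ((1/2) *\<^sub>R a + (1/2) *\<^sub>R b - v))\<^sup>2
    = (norm (a - v))\<^sup>2 / 2 + (norm (b - v))\<^sup>2 / 2 - (norm (a - b))\<^sup>2 / 4"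
  unfolding power2_norm_eq_inner by (simp add: inner_diff inner_add inner_commute field_simps)

text \<open>The quadratic term makes the objective uniformly convex, so by the parallelogram law
  every minimizing sequence is Cauchy. Completeness supplies the limit and lower semicontinuity
  makes it a minimizer.\<close>

lemma prox_objective_minimizer_exists:
  fixes f :: "'a::{real_inner, complete_space} \<Rightarrow> ereal"
  assumes conv: "convex_fun f" and proper: "proper_fun f" and lsc: "lsc_fun f" and t: "t > 0"
    and bound: "\<And>x. ereal m \<le> ereal t * f x + ereal (1 / 2 * (norm (x - v))\<^sup>2)"
  shows "\<exists>x. \<forall>z. ereal t * f x + ereal (1 / 2 * (norm (x - v))\<^sup>2)
                 \<le> ereal t * f z + ereal (1 / 2 * (norm (z - v))\<^sup>2)"
proof -
  define h where "h x = ereal t * f x + ereal (1 / 2 * (norm (x - v))\<^sup>2)" for x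
  obtain z0 where "f z0 \<noteq> \<infinity>" "f z0 \<noteq> -\<infinity>" using proper by (auto simp: proper_fun_def)
  then have "h z0 \<noteq> \<infinity>" by (cases "f z0") (auto simp: h_def)
  moreover have "Inf (range h) \<le> h z0" by (simp add: Inf_lower)
  moreover have "ereal m \<le> Inf (range h)" using bound by (auto simp: h_def intro: Inf_greatest)
  ultimately obtain r where r: "Inf (range h) = ereal r"
    by (cases "Inf (range h)") auto
  have rle: "ereal r \<le> h x" for x using r by (metis Inf_lower rangeI)
  have "\<exists>x. h x < ereal (r + 1 / (real n + 1))" for n
  proof -
    have "Inf (range h) < ereal (r + 1 / (real n + 1))" using r by simp
    then show ?thesis by (auto simp: Inf_less_iff)
  qed
  then obtain s where s: "h (s n) < ereal (r + 1 / (real n + 1))" for n by metis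
  have fin: "\<exists>w. f (s n) = ereal w \<and> r \<le> t * w + (norm (s n - v))\<^sup>2 / 2
      \<and> t * w + (norm (s n - v))\<^sup>2 / 2 < r + 1 / (real n + 1)" for n
    using s[of n] rle[of "s n"] t unfolding h_def by (cases "f (s n)") auto
  \<comment> \<open>At the midpoint the objective is at least \<open>r\<close> and at most the mean
    of the two values minus an eighth of the squared distance. Both values are within a reciprocal
    of \<open>r\<close>, which yields the factor 4.\<close>
  have dist: "(norm (s k - s n))\<^sup>2 \<le> 4 * (1 / (real k + 1) + 1 / (real n + 1))" for k n
  proof -
    obtain a b where a: "f (s k) = ereal a" "t * a + (norm (s k - v))\<^sup>2 / 2 < r + 1 / (real k + 1)"
      and b: "f (s n) = ereal b" "t * b + (norm (s n - v))\<^sup>2 / 2 < r + 1 / (real n + 1)"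
      using fin by meson
    define z where "z = (1/2) *\<^sub>R s k + (1/2) *\<^sub>R s n"
    have "f ((1 - 1/2) *\<^sub>R s k + (1/2) *\<^sub>R s n) \<le> ereal (1 - 1/2) * f (s k) + ereal (1/2) * f (s n)"
      using conv unfolding convex_fun_def by (metis greaterThanLessThan_iff half_gt_zero_iff
          less_numeral_extra(1) field_sum_of_halves less_add_same_cancel1)
    then have "f z \<le> ereal (a / 2 + b / 2)" by (simp add: z_def a b)
    moreover have "ereal r \<le> h z" by (rule rle)
    moreover have "f z \<noteq> -\<infinity>" using proper by (simp add: proper_fun_def)
    ultimately obtain c where c: "c \<le> a / 2 + b / 2" "r \<le> t * c + (norm (z - v))\<^sup>2 / 2"
      by (cases "f z") (auto simp: h_def)
    have "t * c \<le> t * (a / 2 + b / 2)" using c t by simp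
    then have "t * c \<le> t * a / 2 + t * b / 2" by (simp add: distrib_left)
    moreover have "r \<le> t * c + (norm (s k - v))\<^sup>2 / 4 + (norm (s n - v))\<^sup>2 / 4
        - (norm (s k - s n))\<^sup>2 / 8"
      using c(2) unfolding z_def midpoint_norm_identity by (simp add: field_simps)
    ultimately show ?thesis using a(2) b(2) by argo
  qed
  have "Cauchy s"
  proof (rule metric_CauchyI)
    fix e :: real assume e: "e > 0"
    obtain N where N: "1 / (real N + 1) < e\<^sup>2 / 8"
      using reals_Archimedean[of "e\<^sup>2 / 8"] e by (auto simp: inverse_eq_divide add.commute)
    show "\<exists>M. \<forall>m\<ge>M. \<forall>n\<ge>M. dist (s m) (s n) < e"
    proof (intro exI allI impI)
      fix k n assume "N \<le> k" "N \<le> n"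
      then have "1 / (real k + 1) \<le> 1 / (real N + 1)" "1 / (real n + 1) \<le> 1 / (real N + 1)"
        by (auto intro!: divide_left_mono)
      with dist[of k n] N have "(norm (s k - s n))\<^sup>2 < e\<^sup>2" by argo
      with e show "dist (s k) (s n) < e" by (simp add: dist_norm power2_less_imp_less)
    qed
  qed
  then obtain x where x: "s \<longlonglongrightarrow> x" using Cauchy_convergent_iff convergent_def by blast
  \<comment> \<open>This is the bound on \<open>f (s n)\<close> obtained by solving the
    near-minimality inequality for it.\<close>
  have lim: "(\<lambda>n. (r + 1 / (real n + 1) - (norm (s n - v))\<^sup>2 / 2) / t)
      \<longlonglongrightarrow> (r + 0 - (norm (x - v))\<^sup>2 / 2) / t"
  proof (intro tendsto_intros x)
    show "(\<lambda>n. 1 / (real n + 1)) \<longlonglongrightarrow> 0"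
      using LIMSEQ_inverse_real_of_nat by (simp add: inverse_eq_divide add.commute)
  qed (use t in auto)
  have "f x \<le> ereal ((r + 0 - (norm (x - v))\<^sup>2 / 2) / t)"
  proof (rule lsc_fun_seq_le[OF lsc x lim])
    show "f (s n) \<le> ereal ((r + 1 / (real n + 1) - (norm (s n - v))\<^sup>2 / 2) / t)" for n
      using fin[of n] t by (auto simp: pos_le_divide_eq mult.commute)
  qed
  moreover have "f x \<noteq> -\<infinity>" using proper by (simp add: proper_fun_def)
  ultimately have "h x \<le> ereal r" using t by (cases "f x") (auto simp: h_def field_simps)
  then have "\<forall>z. h x \<le> h z" using rle order_trans by blast
  then show ?thesis unfolding h_def by blast
qed

text \<open>Fermat's rule by hand: compare \<open>x\<close> with the point a fraction
  \<open>s\<close> of the way to \<open>z\<close>, divide the inequality by \<open>s\<close>, and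
  let \<open>s\<close> tend to 0.\<close>

lemma prox_objective_minimizer_subgradient:
  fixes f :: "'a::real_inner \<Rightarrow> ereal"
  assumes conv: "convex_fun f" and proper: "proper_fun f" and t: "t > 0"
    and min: "\<And>z. ereal t * f x + ereal (1 / 2 * (norm (x - v))\<^sup>2)
                 \<le> ereal t * f z + ereal (1 / 2 * (norm (z - v))\<^sup>2)"
  shows "(1 / t) *\<^sub>R (v - x) \<in> subdiff f x"
  unfolding subdiff_def
proof (intro CollectI allI)
  fix z
  obtain z0 where "f z0 \<noteq> \<infinity>" "f z0 \<noteq> -\<infinity>" using proper by (auto simp: proper_fun_def)
  then have "f x \<noteq> \<infinity>" using min[of z0] t by (cases "f z0") auto
  moreover have "f x \<noteq> -\<infinity>" using proper by (simp add: proper_fun_def)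
  ultimately obtain a where a: "f x = ereal a" by (cases "f x") auto
  show "f x + ereal ((1 / t) *\<^sub>R (v - x) \<bullet> (z - x)) \<le> f z"
  proof (cases "f z = \<infinity>")
    case False
    then obtain b where b: "f z = ereal b" using proper by (cases "f z") (auto simp: proper_fun_def)
    have *: "(v - x) \<bullet> (z - x) - t * (b - a) \<le> s * ((norm (z - x))\<^sup>2 / 2)" if s: "0 < s" "s < 1" for s
    proof -
      define w where "w = (1 - s) *\<^sub>R x + s *\<^sub>R z"
      have "f w \<le> ereal (1 - s) * f x + ereal s * f z"
        using conv s unfolding convex_fun_def w_def by simp
      moreover have "f w \<noteq> -\<infinity>" using proper by (simp add: proper_fun_def)
      ultimately obtain c where c: "f w = ereal c" "c \<le> (1 - s) * a + s * b"
        by (cases "f w") (auto simp: a b)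
      have "t * a + (norm (x - v))\<^sup>2 / 2 \<le> t * c + (norm (w - v))\<^sup>2 / 2"
        using min[of w] by (simp add: a c)
      moreover have "t * c \<le> t * ((1 - s) * a + s * b)" using c t by simp
      moreover have "(norm (w - v))\<^sup>2
          = (norm (x - v))\<^sup>2 - 2 * s * ((v - x) \<bullet> (z - x)) + s\<^sup>2 * (norm (z - x))\<^sup>2"
        unfolding power2_norm_eq_inner w_def
        by (simp add: inner_simps inner_commute algebra_simps power2_eq_square)
      ultimately have "0 \<le> s * (t * (b - a) - (v - x) \<bullet> (z - x) + s * ((norm (z - x))\<^sup>2 / 2))"
        by (simp add: algebra_simps power2_eq_square)
      with s show ?thesis by (simp add: zero_le_mult_iff)
    qed
    have "((\<lambda>s. s * ((norm (z - x))\<^sup>2 / 2)) \<longlongrightarrow> 0 * ((norm (z - x))\<^sup>2 / 2)) (at_right (0::real))"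
      by (intro tendsto_intros)
    moreover have "\<forall>\<^sub>F s in at_right (0::real). (v - x) \<bullet> (z - x) - t * (b - a) \<le> s * ((norm (z - x))\<^sup>2 / 2)"
      using eventually_at_right_real[OF zero_less_one] by eventually_elim (use * in auto)
    ultimately have "(v - x) \<bullet> (z - x) - t * (b - a) \<le> 0"
      by (intro tendsto_lowerbound[where F="at_right (0::real)"]) auto
    then have "a + (v - x) \<bullet> (z - x) / t \<le> b" using t by (simp add: field_simps)
    then show ?thesis by (simp add: a b)
  qed simp
qed

text \<open>\<open>arg_min\<close> is a choice operator, so a minimizer must be shown to exist
  first. One subgradient anywhere gives an affine minorant of \<open>f\<close>, hence a lower bound
  for the objective.\<close>

lemma prox_subgradient:
  fixes f :: "'a::{real_inner, complete_space} \<Rightarrow> ereal"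
  assumes conv: "convex_fun f" and proper: "proper_fun f" and lsc: "lsc_fun f" and t: "t > 0"
    and r: "r \<in> subdiff f w"
  shows "(1 / t) *\<^sub>R (v - prox t f v) \<in> subdiff f (prox t f v)"
proof -
  let ?h = "\<lambda>x. ereal t * f x + ereal (1 / 2 * (norm (x - v))\<^sup>2)"
  obtain a where a: "f w = ereal a" using subdiff_finite[OF proper r] by auto
  \<comment> \<open>The minimum over \<open>x\<close> of the objective with \<open>f\<close>
    replaced by its affine minorant, attained at \<open>v - t *\<^sub>R r\<close>.\<close>
  define m where "m = t * (a + r \<bullet> (v - w)) - t\<^sup>2 * (norm r)\<^sup>2 / 2"
  have "ereal m \<le> ?h x" for x
  proof -
    have "f w + ereal (r \<bullet> (x - w)) \<le> f x" using r by (simp add: subdiff_def)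
    then have fx: "ereal (a + r \<bullet> (x - w)) \<le> f x" by (simp add: a)
    have "0 \<le> (norm (t *\<^sub>R r + (x - v)))\<^sup>2" by simp
    also have "\<dots> = t\<^sup>2 * (norm r)\<^sup>2 + 2 * t * (r \<bullet> (x - v)) + (norm (x - v))\<^sup>2"
      unfolding power2_norm_eq_inner
      by (simp add: inner_simps inner_commute algebra_simps power2_eq_square)
    finally have "m \<le> t * (a + r \<bullet> (x - w)) + (norm (x - v))\<^sup>2 / 2"
      by (simp add: m_def algebra_simps inner_simps)
    then have m: "m - (norm (x - v))\<^sup>2 / 2 \<le> t * (a + r \<bullet> (x - w))" by linarith
    show ?thesis
    proof (cases "f x")
      case (real b)
      then have "t * (a + r \<bullet> (x - w)) \<le> t * b" using fx t by simp
      with m real show ?thesis by simp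
    qed (use fx t in auto)
  qed
  then obtain x where "is_arg_min ?h (\<lambda>_. True) x"
    using prox_objective_minimizer_exists[OF conv proper lsc t, of m v]
    by (auto simp: is_arg_min_def not_less)
  then have "is_arg_min ?h (\<lambda>_. True) (prox t f v)"
    unfolding prox_def arg_min_def by (rule someI)
  then show ?thesis
    by (intro prox_objective_minimizer_subgradient[OF conv proper t]) (auto simp: is_arg_min_def not_less)
qed

section \<open>Adjoints in Hilbert spaces\<close>

text \<open>
  The representing vector of \<open>\<phi>\<close> minimizes \<open>(norm x)\<^sup>2 / 2 - \<phi> x\<close>, that is, it is the value at
  \<open>0\<close> of the proximal map of \<open>- \<phi>\<close>.
\<close>

lemma riesz_representation_exists:
  fixes \<phi> :: "'a::{real_inner, complete_space} \<Rightarrow> real"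
  assumes "bounded_linear \<phi>"
  shows "\<exists>w. \<forall>x. \<phi> x = x \<bullet> w"
proof -
  interpret bounded_linear \<phi> by fact
  let ?f = "\<lambda>x. ereal (- \<phi> x)"
  have conv: "convex_fun ?f" by (simp add: convex_fun_def add scaleR)
  have proper: "proper_fun ?f" by (simp add: proper_fun_def)
  have lsc: "lsc_fun ?f"
    unfolding lsc_fun_def
  proof
    fix x
    have "((\<lambda>z. - \<phi> z) \<longlongrightarrow> - \<phi> x) (nhds x)"
      by (intro tendsto_intros tendsto filterlim_ident)
    then have "(?f \<longlongrightarrow> ?f x) (nhds x)" by simp
    then have "Liminf (nhds x) ?f = ?f x" by (intro lim_imp_Liminf) simp_all
    then show "?f x \<le> Liminf (nhds x) ?f" by simp
  qed
  have "ereal (- (onorm \<phi>)\<^sup>2 / 2) \<le> ereal 1 * ?f x + ereal (1 / 2 * (norm (x - 0))\<^sup>2)" for x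
  proof -
    have "\<phi> x \<le> onorm \<phi> * norm x" using onorm[OF assms, of x] by simp
    moreover have "0 \<le> (onorm \<phi> - norm x)\<^sup>2" by simp
    ultimately show ?thesis by (simp add: power2_eq_square algebra_simps)
  qed
  from prox_objective_minimizer_exists[OF conv proper lsc zero_less_one this]
  obtain w where "\<And>z. ereal 1 * ?f w + ereal (1 / 2 * (norm (w - 0))\<^sup>2)
                 \<le> ereal 1 * ?f z + ereal (1 / 2 * (norm (z - 0))\<^sup>2)"
    by blast
  then have w: "(1/1) *\<^sub>R (0 - w) \<in> subdiff ?f w"
    by (rule prox_objective_minimizer_subgradient[OF conv proper zero_less_one])
  have le: "\<phi> d \<le> d \<bullet> w" for d
  proof -
    have "?f w + ereal (((1/1) *\<^sub>R (0 - w)) \<bullet> ((w + d) - w)) \<le> ?f (w + d)"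
      using w unfolding subdiff_def by blast
    then show ?thesis by (simp add: add inner_commute)
  qed
  have "\<phi> d = d \<bullet> w" for d using le[of d] le[of "- d"] by (simp add: linear_neg[OF bounded_linear.linear[OF assms]])
  then show ?thesis by blast
qed

text \<open>\<open>adjoint\<close> is also defined by choice; representing each functional
  \<open>K x \<bullet> y\<close> of \<open>x\<close> by a vector shows that a suitable map
  exists.\<close>

lemma adjoint_inner:
  fixes K :: "'a::{real_inner, complete_space} \<Rightarrow> 'b::real_inner"
  assumes "bounded_linear K"
  shows "K x \<bullet> y = x \<bullet> adjoint K y"
proof -
  have "\<exists>w. \<forall>x. K x \<bullet> y = x \<bullet> w" for y
    by (rule riesz_representation_exists)
      (rule bounded_linear_compose[OF bounded_linear_inner_left assms])
  then have ex: "\<exists>A. \<forall>x y. K x \<bullet> y = x \<bullet> A y" by metis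
  show ?thesis using someI_ex[OF ex] unfolding adjoint_def by blast
qed

section \<open>Bregman distances and the preconditioner norm\<close>

definition bregman :: "('a::real_inner \<Rightarrow> ereal) \<Rightarrow> 'a \<Rightarrow> 'a \<Rightarrow> 'a \<Rightarrow> real" where
  "bregman f r w x = real_of_ereal (f x) - real_of_ereal (f w) - r \<bullet> (x - w)"

lemma bregman_nonneg:
  assumes "proper_fun f" "r \<in> subdiff f w" "\<bar>f x\<bar> \<noteq> \<infinity>"
  shows "0 \<le> bregman f r w x"
  using subdiff_real_ineq[OF assms] by (simp add: bregman_def)

text \<open>Use the subgradient inequality at \<open>x'\<close> towards \<open>w\<close> with weight
  1 and towards \<open>x\<close> with weight \<open>\<theta> - 1\<close>. The terms in
  \<open>r\<close> are affine and match exactly.\<close>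

lemma bregman_extrapolation_le:
  assumes proper: "proper_fun f" and r: "r \<in> subdiff f w" and p: "p \<in> subdiff f x'"
    and x: "\<bar>f x\<bar> \<noteq> \<infinity>" and th: "1 \<le> \<theta>"
  shows "\<theta> * bregman f r w x' - (\<theta> - 1) * bregman f r w x
    \<le> (p - r) \<bullet> (x' + (\<theta> - 1) *\<^sub>R (x' - x) - w)"
proof -
  have "real_of_ereal (f x') + p \<bullet> (w - x') \<le> real_of_ereal (f w)"
    by (rule subdiff_real_ineq[OF proper p subdiff_finite[OF proper r]])
  moreover have "(\<theta> - 1) * (real_of_ereal (f x') + p \<bullet> (x - x')) \<le> (\<theta> - 1) * real_of_ereal (f x)"
    using subdiff_real_ineq[OF proper p x] th by (intro mult_left_mono) auto
  ultimately show ?thesis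
    by (simp add: bregman_def inner_simps algebra_simps)
qed

text \<open>The two subgradients turn the bilinear terms of the gap into the linear parts of the
  Bregman distances; the products of \<open>K xh\<close> and \<open>yh\<close> cancel.\<close>

lemma lagrangian_gap_eq_bregman:
  assumes adj: "\<And>x y. K x \<bullet> y = x \<bullet> Ka y"
    and "\<bar>G x\<bar> \<noteq> \<infinity>" "\<bar>G xh\<bar> \<noteq> \<infinity>" "\<bar>Fs y\<bar> \<noteq> \<infinity>" "\<bar>Fs yh\<bar> \<noteq> \<infinity>"
  shows "lagrangian_gap K G Fs (x, y) (xh, yh)
    = ereal (bregman G (- Ka yh) xh x + bregman Fs (K xh) yh y)"
  using assms(2-) adj[of x yh] adj[of xh yh]
  by (cases "G x"; cases "G xh"; cases "Fs y"; cases "Fs yh")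
    (auto simp: lagrangian_gap_def bregman_def inner_simps inner_commute)

text \<open>Half the quadratic form of the block operator with diagonal \<open>1/\<tau>\<close>,
  \<open>1/\<sigma>\<close> and off-diagonal entries \<open>-K\<close> and minus its
  adjoint.\<close>

definition precond :: "('a::real_inner \<Rightarrow> 'b::real_inner) \<Rightarrow> real \<Rightarrow> real \<Rightarrow> 'a \<Rightarrow> 'b \<Rightarrow> real" where
  "precond K \<tau> \<sigma> x y = (norm x)\<^sup>2 / (2 * \<tau>) - K x \<bullet> y + (norm y)\<^sup>2 / (2 * \<sigma>)"

text \<open>Young's inequality with weight \<open>\<sigma>\<close> on the coupling term; the step
  length condition absorbs the rest.\<close>

lemma precond_nonneg:
  assumes K: "bounded_linear K" and pos: "\<tau> > 0" "\<sigma> > 0" and le: "\<tau> * \<sigma> * (onorm K)\<^sup>2 \<le> 1"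
  shows "0 \<le> precond K \<tau> \<sigma> x y"
proof -
  let ?k = "onorm K"
  have "K x \<bullet> y \<le> norm (K x) * norm y" by (rule norm_cauchy_schwarz)
  also have "\<dots> \<le> ?k * norm x * norm y"
    by (intro mult_right_mono onorm[OF K]) auto
  also have "\<dots> \<le> \<sigma> * (?k * norm x)\<^sup>2 / 2 + (norm y)\<^sup>2 / (2 * \<sigma>)"
  proof -
    have "0 \<le> (\<sigma> * (?k * norm x) - norm y)\<^sup>2 / (2 * \<sigma>)" using pos by simp
    also have "\<dots> = \<sigma> * (?k * norm x)\<^sup>2 / 2 + (norm y)\<^sup>2 / (2 * \<sigma>) - ?k * norm x * norm y"
      using pos by (simp add: field_simps power2_eq_square)
    finally show ?thesis by simp
  qed
  also have "\<sigma> * (?k * norm x)\<^sup>2 / 2 \<le> (norm x)\<^sup>2 / (2 * \<tau>)"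
  proof -
    have "\<tau> * \<sigma> * ?k\<^sup>2 * (norm x)\<^sup>2 \<le> 1 * (norm x)\<^sup>2" by (intro mult_right_mono le) simp
    then show ?thesis using pos by (simp add: field_simps power_mult_distrib)
  qed
  finally show ?thesis by (simp add: precond_def)
qed

text \<open>The over-relaxation \<open>2 *\<^sub>R x' - x\<close> makes the coupling symmetric: the
  left side is minus the preconditioner's bilinear form of the increment and the new error.
  Polarization gives the rest.\<close>

lemma precond_three_point:
  assumes K: "linear K" and adj: "\<And>x y. K x \<bullet> y = x \<bullet> Ka y"
  shows "(- ((1 / \<tau>) *\<^sub>R (x' - x)) - Ka y + Ka yh) \<bullet> (x' - xh)
       + (- ((1 / \<sigma>) *\<^sub>R (y' - y)) + K (2 *\<^sub>R x' - x) - K xh) \<bullet> (y' - yh)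
    = precond K \<tau> \<sigma> (x - xh) (y - yh) - precond K \<tau> \<sigma> (x' - xh) (y' - yh)
      - precond K \<tau> \<sigma> (x' - x) (y' - y)"
proof -
  define X X' Y Y' where "X = x - xh" and "X' = x' - xh" and "Y = y - yh" and "Y' = y' - yh"
  have lin: "K (u - w) = K u - K w" "K (c *\<^sub>R u) = c *\<^sub>R K u" for u w c
    using K by (simp_all add: linear_diff linear_scale)
  have adj': "Ka y \<bullet> x = K x \<bullet> y" for x y by (metis adj inner_commute)
  have diff: "x' - x = X' - X" "y' - y = Y' - Y" by (simp_all add: X_def X'_def Y_def Y'_def)
  have primal: "(- ((1 / \<tau>) *\<^sub>R (X' - X)) - Ka y + Ka yh) \<bullet> X'
      = - ((X' - X) \<bullet> X' / \<tau>) - K X' \<bullet> Y"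
    by (simp add: inner_add_left inner_diff_left inner_diff_right adj' Y_def diff_divide_distrib)
  have K_eq: "K (2 *\<^sub>R x' - x) - K xh = 2 *\<^sub>R K X' - K X"
    by (simp add: X_def X'_def lin scaleR_diff_right) (simp add: scaleR_2)
  have dual: "(- ((1 / \<sigma>) *\<^sub>R (Y' - Y)) + K (2 *\<^sub>R x' - x) - K xh) \<bullet> Y'
      = - ((Y' - Y) \<bullet> Y' / \<sigma>) + 2 * (K X' \<bullet> Y') - K X \<bullet> Y'"
    unfolding add_diff_eq[symmetric] K_eq
    by (simp add: inner_add_left inner_diff_left diff_divide_distrib)
  have polar: "(norm (u' - u))\<^sup>2 / (2 * t) = (u' - u) \<bullet> u' / t + (norm u)\<^sup>2 / (2 * t) - (norm u')\<^sup>2 / (2 * t)"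
    for u u' :: "'c::real_inner" and t
    unfolding power2_norm_eq_inner
    by (cases "t = 0") (simp_all add: inner_diff_left inner_diff_right inner_commute field_simps)
  show ?thesis
    unfolding diff X_def[symmetric] X'_def[symmetric] Y_def[symmetric] Y'_def[symmetric] primal dual
    by (simp add: precond_def polar lin inner_diff_left inner_diff_right)
qed

text \<open>
  The inertia parameter \<open>l\<close> is exactly what makes the step from the inertial point a scaled
  increment of the corrected iterates.
\<close>

lemma inertial_step_eq:
  fixes x x' d :: "'a::real_vector"
  assumes "l * \<theta> = 1"
  shows "x' - (x + (l * e) *\<^sub>R d) = l *\<^sub>R ((x' + (\<theta> - 1) *\<^sub>R (x' - x)) - (x + e *\<^sub>R d))"
proof -
  have "l *\<^sub>R (\<theta> *\<^sub>R z) = z" for z :: 'a using assms by simp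
  moreover have "(x' + (\<theta> - 1) *\<^sub>R (x' - x)) - (x + e *\<^sub>R d) = \<theta> *\<^sub>R (x' - x) - e *\<^sub>R d"
    by (simp add: algebra_simps)
  ultimately show ?thesis by (simp add: algebra_simps)
qed

section \<open>Convergence rate of the Lagrangian gap\<close>

theorem theorem4p5:
  fixes K :: "'a::{real_inner, complete_space} \<Rightarrow> 'b::{real_inner, complete_space}"
    and G :: "'a \<Rightarrow> ereal" and F Fs :: "'b \<Rightarrow> ereal"
    and \<gamma> \<rho> \<epsilon> :: real
    and \<tau> \<sigma> lam mu \<omega> :: "nat \<Rightarrow> real"
    and x xb xt :: "nat \<Rightarrow> 'a" and y yb yt :: "nat \<Rightarrow> 'b"
    and xh :: 'a and yh :: 'b
  assumes K: "bounded_linear K"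
    and G: "convex_fun G" "proper_fun G" "lsc_fun G" "strongly_convex_fun \<gamma> G"
    and F: "convex_fun F" "proper_fun F" "lsc_fun F"
    and Fs_eq: "Fs = fenchel_conj F"
    and Fs: "convex_fun Fs" "proper_fun Fs" "lsc_fun Fs" "strongly_convex_fun \<rho> Fs"
    and factors: "\<gamma> = 0" "\<rho> = 0"
    and init: "\<tau> 0 > 0" "\<sigma> 0 > 0" "\<tau> 0 * \<sigma> 0 * (onorm K)\<^sup>2 < 1" "lam 0 = 1" "mu 0 = 1"
    and eps: "0 \<le> \<epsilon>" "\<epsilon> < 1"
    and tau_step: "\<And>i. \<tau> (i + 1) = \<tau> i * inverse (lam i) * lam (i + 1)"
    and omega_step: "\<And>i. \<omega> i = 1"
    and sigma_step: "\<And>i. \<sigma> (i + 1) = \<sigma> i * inverse (lam i) * lam (i + 1)"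
    and mu_step: "\<And>i. mu (i + 1) = lam (i + 1)"
    and lam_step: "\<And>i. lam (i + 1) = lam i / (1 + (1 - \<epsilon>) * lam i)"
    and alg: "ic_pdps K G Fs \<gamma> \<rho> \<tau> \<sigma> lam mu \<omega> x xb xt y yb yt"
    and crit: "(xh, yh) \<in> critical_points K G Fs"
  shows "(\<lambda>N. lagrangian_gap K G Fs (x N, y N) (xh, yh)) \<longlonglongrightarrow> 0 \<and>
         (\<lambda>N. real_of_ereal (lagrangian_gap K G Fs (x N, y N) (xh, yh))) \<in> O(\<lambda>N. 1 / real N)"
proof -
  interpret K: bounded_linear K by fact
  let ?Ka = "adjoint K"
  have adj: "K x \<bullet> y = x \<bullet> ?Ka y" for x y by (rule adjoint_inner[OF K])
  define c where "c = 1 - \<epsilon>"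
  have c: "0 < c" "c \<le> 1" using eps by (auto simp: c_def)
  define \<theta> where "\<theta> n = 1 + c * real n" for n
  have th: "1 \<le> \<theta> n" "0 < \<theta> n" for n using c by (auto simp: \<theta>_def add_pos_nonneg)
  \<comment> \<open>This is where \<open>0 \<le> \<epsilon>\<close> enters, through
    \<open>c \<le> 1\<close>.\<close>
  have th_Suc: "\<theta> (Suc n) - 1 \<le> \<theta> n" for n using c by (simp add: \<theta>_def algebra_simps)
  have lam: "lam n = 1 / \<theta> n" for n
  proof (induction n)
    case (Suc n)
    have "lam (Suc n) = lam n / (1 + c * lam n)" using lam_step[of n] by (simp add: c_def)
    also have "\<dots> = 1 / (\<theta> n + c)" using th(2)[of n] by (simp add: Suc field_simps)
    also have "\<theta> n + c = \<theta> (Suc n)" by (simp add: \<theta>_def algebra_simps)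
    finally show ?case .
  qed (simp add: init \<theta>_def)
  have lamp: "0 < lam n" "lam n * \<theta> n = 1" "inverse (lam n) = \<theta> n" for n
    using th(2)[of n] by (auto simp: lam)
  have mu: "mu n = lam n" for n using mu_step init by (cases n) auto
  have tau: "\<tau> n = \<tau> 0 * lam n" for n
    using tau_step lamp(1) by (induction n) (auto simp: init less_imp_neq[symmetric])
  have sigma: "\<sigma> n = \<sigma> 0 * lam n" for n
    using sigma_step lamp(1) by (induction n) (auto simp: init less_imp_neq[symmetric])
  \<comment> \<open>With zero factors the averaged points are \<open>xb\<close> and
    \<open>yb\<close>. The dual weights are one index ahead of the primal ones, as the method uses
    \<open>mu (i + 1)\<close> next to \<open>lam i\<close>.\<close>
  have xS: "x (Suc n) = prox (\<tau> n) G (xb n - \<tau> n *\<^sub>R ?Ka (yt n))"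
    and xbS: "xb (Suc n) = x (Suc n) + (lam (Suc n) * (\<theta> n - 1)) *\<^sub>R (x (Suc n) - x n)"
    and xtS: "xt (Suc n) = x (Suc n) + (\<theta> n - 1) *\<^sub>R (x (Suc n) - x n)"
    and yS: "y (Suc n) = prox (\<sigma> (Suc n)) Fs (yb n + \<sigma> (Suc n) *\<^sub>R K (2 *\<^sub>R xt (Suc n) - xt n))"
    and ybS: "yb (Suc n) = y (Suc n) + (lam (Suc (Suc n)) * (\<theta> (Suc n) - 1)) *\<^sub>R (y (Suc n) - y n)"
    and ytS: "yt (Suc n) = y (Suc n) + (\<theta> (Suc n) - 1) *\<^sub>R (y (Suc n) - y n)" for n
    using alg factors
    by (simp_all add: ic_pdps_def Let_def omega_step mu lamp(3) scaleR_2 add_diff_eq)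
  \<comment> \<open>These subgradients at the critical point serve twice: they make the proximal
    maps well-defined and they are the slopes of the Bregman distances.\<close>
  define r where "r = - ?Ka yh"
  define s where "s = K xh"
  have r: "r \<in> subdiff G xh" and s: "s \<in> subdiff Fs yh"
    using crit by (auto simp: critical_points_def r_def s_def)
  have p: "(1 / \<tau> n) *\<^sub>R (xb n - \<tau> n *\<^sub>R ?Ka (yt n) - x (Suc n)) \<in> subdiff G (x (Suc n))" for n
    unfolding xS using init lamp by (intro prox_subgradient[OF G(1-3) _ r]) (simp add: tau[of n])
  have q: "(1 / \<sigma> (Suc n)) *\<^sub>R (yb n + \<sigma> (Suc n) *\<^sub>R K (2 *\<^sub>R xt (Suc n) - xt n) - y (Suc n))
      \<in> subdiff Fs (y (Suc n))" for n
    unfolding yS using init lamp by (intro prox_subgradient[OF Fs(1-3) _ s]) (simp add: sigma[of "Suc n"])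
  \<comment> \<open>Finiteness is available only from index 1 on, since \<open>G (x 0)\<close> may
    be infinite; hence the shifted indices below.\<close>
  have finx: "\<bar>G (x (Suc n))\<bar> \<noteq> \<infinity>" for n by (rule subdiff_finite[OF G(2) p])
  have finy: "\<bar>Fs (y (Suc n))\<bar> \<noteq> \<infinity>" for n by (rule subdiff_finite[OF Fs(2) q])
  \<comment> \<open>The factor \<open>lam (Suc n)\<close> of the step cancels against the one in
    \<open>\<tau> (Suc n)\<close>, which leaves the constant \<open>\<tau> 0\<close>.\<close>
  have p': "- ((1 / \<tau> 0) *\<^sub>R (xt (Suc (Suc n)) - xt (Suc n))) - ?Ka (yt (Suc n))
      \<in> subdiff G (x (Suc (Suc n)))" for n
  proof -
    let ?l = "lam (Suc n)"
    have "x (Suc (Suc n)) - xb (Suc n) = ?l *\<^sub>R (xt (Suc (Suc n)) - xt (Suc n))"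
      unfolding xbS xtS by (rule inertial_step_eq[OF lamp(2)])
    then have eq: "xb (Suc n) - \<tau> (Suc n) *\<^sub>R ?Ka (yt (Suc n)) - x (Suc (Suc n))
        = - (?l *\<^sub>R (xt (Suc (Suc n)) - xt (Suc n))) - (\<tau> 0 * ?l) *\<^sub>R ?Ka (yt (Suc n))"
      by (simp add: tau[of "Suc n"] algebra_simps)
    have "(1 / \<tau> (Suc n)) *\<^sub>R (xb (Suc n) - \<tau> (Suc n) *\<^sub>R ?Ka (yt (Suc n)) - x (Suc (Suc n)))
        = - ((1 / \<tau> 0) *\<^sub>R (xt (Suc (Suc n)) - xt (Suc n))) - ?Ka (yt (Suc n))"
      unfolding eq using lamp(1)[of "Suc n"] init(1)
      by (simp add: tau[of "Suc n"] scaleR_diff_right)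
    then show ?thesis using p[of "Suc n"] by simp
  qed
  have q': "- ((1 / \<sigma> 0) *\<^sub>R (yt (Suc (Suc n)) - yt (Suc n))) + K (2 *\<^sub>R xt (Suc (Suc n)) - xt (Suc n))
      \<in> subdiff Fs (y (Suc (Suc n)))" for n
  proof -
    let ?l = "lam (Suc (Suc n))" and ?z = "K (2 *\<^sub>R xt (Suc (Suc n)) - xt (Suc n))"
    have "y (Suc (Suc n)) - yb (Suc n) = ?l *\<^sub>R (yt (Suc (Suc n)) - yt (Suc n))"
      unfolding ybS ytS by (rule inertial_step_eq[OF lamp(2)])
    then have eq: "yb (Suc n) + \<sigma> (Suc (Suc n)) *\<^sub>R ?z - y (Suc (Suc n))
        = - (?l *\<^sub>R (yt (Suc (Suc n)) - yt (Suc n))) + (\<sigma> 0 * ?l) *\<^sub>R ?z"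
      by (simp add: sigma[of "Suc (Suc n)"] algebra_simps)
    have "(1 / \<sigma> (Suc (Suc n))) *\<^sub>R (yb (Suc n) + \<sigma> (Suc (Suc n)) *\<^sub>R ?z - y (Suc (Suc n)))
        = - ((1 / \<sigma> 0) *\<^sub>R (yt (Suc (Suc n)) - yt (Suc n))) + ?z"
      unfolding eq using lamp(1)[of "Suc (Suc n)"] init(2)
      by (simp add: sigma[of "Suc (Suc n)"] scaleR_diff_right scaleR_add_right)
    then show ?thesis using q[of "Suc n"] by simp
  qed
  define a where "a n = bregman G r xh (x n)" for n
  define b where "b n = bregman Fs s yh (y n)" for n
  have a0: "0 \<le> a (Suc n)" and b0: "0 \<le> b (Suc n)" for n
    unfolding a_def b_def by (intro bregman_nonneg G(2) Fs(2) r s finx finy)+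
  define M where "M = precond K (\<tau> 0) (\<sigma> 0)"
  have M0: "0 \<le> M u v" for u v
    unfolding M_def using init by (intro precond_nonneg[OF K]) auto
  define V where "V n = \<theta> n * a (Suc n) + \<theta> (Suc n) * b (Suc n)
      + M (xt (Suc n) - xh) (yt (Suc n) - yh)" for n
  have V_step: "V (Suc n) \<le> V n" for n
  proof -
    let ?n = "Suc n" and ?m = "Suc (Suc n)"
    \<comment> \<open>Folding with \<open>xtS\<close> recognizes the extrapolated test point as the
      corrected iterate.\<close>
    have A: "\<theta> ?n * a ?m - (\<theta> ?n - 1) * a ?n
        \<le> (- ((1 / \<tau> 0) *\<^sub>R (xt ?m - xt ?n)) - ?Ka (yt ?n) - r) \<bullet> (xt ?m - xh)"
      unfolding a_def
      by (rule bregman_extrapolation_le[OF G(2) r p'[of n] finx[of n] th(1)[of ?n], folded xtS[of ?n]])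
    have B: "\<theta> ?m * b ?m - (\<theta> ?m - 1) * b ?n
        \<le> (- ((1 / \<sigma> 0) *\<^sub>R (yt ?m - yt ?n)) + K (2 *\<^sub>R xt ?m - xt ?n) - s) \<bullet> (yt ?m - yh)"
      unfolding b_def
      by (rule bregman_extrapolation_le[OF Fs(2) s q'[of n] finy[of n] th(1)[of ?m], folded ytS[of ?n]])
    have "(- ((1 / \<tau> 0) *\<^sub>R (xt ?m - xt ?n)) - ?Ka (yt ?n) - r) \<bullet> (xt ?m - xh)
        + (- ((1 / \<sigma> 0) *\<^sub>R (yt ?m - yt ?n)) + K (2 *\<^sub>R xt ?m - xt ?n) - s) \<bullet> (yt ?m - yh)
      = M (xt ?n - xh) (yt ?n - yh) - M (xt ?m - xh) (yt ?m - yh) - M (xt ?m - xt ?n) (yt ?m - yt ?n)"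
      unfolding M_def precond_three_point[OF K.linear adj, symmetric] by (simp add: r_def s_def)
    moreover have "(\<theta> ?n - 1) * a ?n \<le> \<theta> n * a ?n" "(\<theta> ?m - 1) * b ?n \<le> \<theta> ?n * b ?n"
      by (intro mult_right_mono th_Suc a0 b0)+
    ultimately show ?thesis
      using A B M0[of "xt ?m - xt ?n" "yt ?m - yt ?n"] unfolding V_def by linarith
  qed
  have V: "V n \<le> V 0" for n
    by (induction n) (use V_step order_trans in auto)
  have gap: "lagrangian_gap K G Fs (x (Suc n), y (Suc n)) (xh, yh) = ereal (a (Suc n) + b (Suc n))" for n
    unfolding a_def b_def r_def s_def
    using finx finy subdiff_finite[OF G(2) r] subdiff_finite[OF Fs(2) s]
    by (intro lagrangian_gap_eq_bregman adj)
  have bound: "a (Suc n) + b (Suc n) \<le> V 0 / c * (1 / real (Suc n))" for n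
  proof -
    \<comment> \<open>Both weights in \<open>V\<close> dominate the same linear function, again by
      \<open>c \<le> 1\<close>, so they can be replaced by one common factor of the gap.\<close>
    have "c * real (Suc n) \<le> \<theta> n" "c * real (Suc n) \<le> \<theta> (Suc n)"
      using c by (auto simp: \<theta>_def algebra_simps)
    then have "c * real (Suc n) * a (Suc n) \<le> \<theta> n * a (Suc n)"
      and "c * real (Suc n) * b (Suc n) \<le> \<theta> (Suc n) * b (Suc n)"
      by (simp_all only: mult_right_mono a0 b0)
    then have "c * real (Suc n) * (a (Suc n) + b (Suc n)) \<le> V 0"
      using V[of n] M0[of "xt (Suc n) - xh" "yt (Suc n) - yh"]
      unfolding V_def by (simp only: distrib_left)
    moreover have "0 < c * real (Suc n)" using c by simp
    ultimately have "a (Suc n) + b (Suc n) \<le> V 0 / (c * real (Suc n))"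
      by (simp only: pos_le_divide_eq mult.commute)
    then show ?thesis by simp
  qed
  have "(\<lambda>n. a (Suc n) + b (Suc n)) \<longlonglongrightarrow> 0"
  proof (rule tendsto_sandwich[where f = "\<lambda>_. 0"])
    show "(\<lambda>n. V 0 / c * (1 / real (Suc n))) \<longlonglongrightarrow> 0"
      using tendsto_mult_right_zero[OF LIMSEQ_inverse_real_of_nat, of "V 0 / c"]
      unfolding inverse_eq_divide .
  qed (use bound in \<open>auto simp: a0 b0\<close>)
  then have "(\<lambda>n. lagrangian_gap K G Fs (x (Suc n), y (Suc n)) (xh, yh)) \<longlonglongrightarrow> 0"
    by (simp add: gap zero_ereal_def)
  then have "(\<lambda>N. lagrangian_gap K G Fs (x N, y N) (xh, yh)) \<longlonglongrightarrow> 0"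
    by (rule LIMSEQ_imp_Suc)
  moreover have "(\<lambda>N. real_of_ereal (lagrangian_gap K G Fs (x N, y N) (xh, yh))) \<in> O(\<lambda>N. 1 / real N)"
  proof (rule bigoI)
    show "\<forall>\<^sub>F N in sequentially. norm (real_of_ereal (lagrangian_gap K G Fs (x N, y N) (xh, yh)))
        \<le> V 0 / c * norm (1 / real N)"
      \<comment> \<open>Index 0 is excluded: the bound covers successors only, and
        \<open>1 / real 0\<close> is 0.\<close>
      using eventually_gt_at_top[of 0]
    proof eventually_elim
      case (elim N)
      then obtain n where n: "N = Suc n" by (cases N) auto
      show ?case using bound[of n] a0[of n] b0[of n] unfolding n gap by simp
    qed
  qed
  ultimately show ?thesis by blast
qed

end
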